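(* Let $X$ be an implicative-orthomodular lattice. The following are equivalent: (a) $X$ is an implicative-Boolean algebra; (b) $x\wedge_Q y=(x\to y^* )^*$ for all $x,y\in X$; (c) $x\wedge_Q y=y\wedge_Q x$ for all $x,y\in X$; (d) $x\vee_Q y=y\vee_Q x$ for all $x,y\in X$; (e) $x\,\mathcal{C}\,y$ and $y\,\mathcal{C}\,x$ for all $x,y\in X$; (f) $x\,\mathcal{D}\,y$ and $y\,\mathcal{D}\,x$ for all $x,y\in X$.
   Context: A BE algebra is an algebra $(X,\to,1)$ such that for all $x,y,z\in X$: $x\to x=1$; $x\to 1=1$; $1\to x=x$; $x\to(y\to z)=y\to(x\to z)$. It carries the relation $x\le y$ iff $x\to y=1$. It is bounded if there is $0\in X$ with $0\le x$ for all $x\in X$; then $x^*:=x\to 0$ (so $0=1^*$) and the algebra is written $(X,\to,{}^*,1)$. It is involutive if $x^{**}=x$ for all $x$, and implicative if $(x\to y)\to x=x$ for all $x,y$. An implicative-ortholattice is an implicative involutive (bounded) BE algebra. Put $x\vee_Q y:=(x\to y)\to y$ and $x\wedge_Q y:=((x^*\to y^* )\to y^* )^*$. An implicative-orthomodular lattice is an implicative-ortholattice with $x\wedge_Q(y\to x)=x$ for all $x,y$. An implicative-Boolean algebra is an implicative-ortholattice with $(y^*\to x)\to y=x\to y$ for all $x,y$. The commutativity relation: $x\,\mathcal{C}\,y$ iff $y\wedge_Q x=(x\to y^* )^*$. The divisibility relation: $x\,\mathcal{D}\,y$ iff $x\to(x\to y)^*=x\to y^*$. *)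

theory Defs
  imports "HOL-Algebra.Congruence"
begin

(* The axioms of an algebra are relativised to its carrier set, in the style of HOL-Algebra;
   a structure argument that is fixed with (structure) is left implicit in the notation.
   The implication is written \<leadsto>, because \<rightarrow> denotes the function space, and the
   complement \<star>, because * as an exponent denotes the reflexive transitive closure. *)

record 'a be_algebra = "'a partial_object" +
  imp :: "['a, 'a] \<Rightarrow> 'a" (infixr \<open>\<leadsto>\<index>\<close> 65)
  one :: 'a (\<open>\<one>\<index>\<close>)

record 'a bounded_be_algebra = "'a be_algebra" +
  zero :: 'a (\<open>\<zero>\<index>\<close>)

definition be_le :: "('a, 'm) be_algebra_scheme \<Rightarrow> 'a \<Rightarrow> 'a \<Rightarrow> bool" (infix \<open>\<preceq>\<index>\<close> 50)
  where "x \<preceq>\<^bsub>X\<^esub> y \<longleftrightarrow> x \<leadsto>\<^bsub>X\<^esub> y = \<one>\<^bsub>X\<^esub>"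

definition compl :: "('a, 'm) bounded_be_algebra_scheme \<Rightarrow> 'a \<Rightarrow> 'a" (\<open>_\<^sup>\<star>\<index>\<close> [100] 100)
  where "x\<^sup>\<star>\<^bsub>X\<^esub> = x \<leadsto>\<^bsub>X\<^esub> \<zero>\<^bsub>X\<^esub>"

definition join_Q :: "('a, 'm) bounded_be_algebra_scheme \<Rightarrow> 'a \<Rightarrow> 'a \<Rightarrow> 'a" (infixl \<open>\<squnion>\<index>\<close> 70)
  where "x \<squnion>\<^bsub>X\<^esub> y = (x \<leadsto>\<^bsub>X\<^esub> y) \<leadsto>\<^bsub>X\<^esub> y"

definition meet_Q :: "('a, 'm) bounded_be_algebra_scheme \<Rightarrow> 'a \<Rightarrow> 'a \<Rightarrow> 'a" (infixl \<open>\<sqinter>\<index>\<close> 70)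
  where "x \<sqinter>\<^bsub>X\<^esub> y = ((x\<^sup>\<star>\<^bsub>X\<^esub> \<leadsto>\<^bsub>X\<^esub> y\<^sup>\<star>\<^bsub>X\<^esub>) \<leadsto>\<^bsub>X\<^esub> y\<^sup>\<star>\<^bsub>X\<^esub>)\<^sup>\<star>\<^bsub>X\<^esub>"

definition commutes :: "('a, 'm) bounded_be_algebra_scheme \<Rightarrow> 'a \<Rightarrow> 'a \<Rightarrow> bool" (infix \<open>\<C>\<index>\<close> 50)
  where "x \<C>\<^bsub>X\<^esub> y \<longleftrightarrow> y \<sqinter>\<^bsub>X\<^esub> x = (x \<leadsto>\<^bsub>X\<^esub> y\<^sup>\<star>\<^bsub>X\<^esub>)\<^sup>\<star>\<^bsub>X\<^esub>"

definition divides :: "('a, 'm) bounded_be_algebra_scheme \<Rightarrow> 'a \<Rightarrow> 'a \<Rightarrow> bool" (infix \<open>\<D>\<index>\<close> 50)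
  where "x \<D>\<^bsub>X\<^esub> y \<longleftrightarrow> x \<leadsto>\<^bsub>X\<^esub> (x \<leadsto>\<^bsub>X\<^esub> y)\<^sup>\<star>\<^bsub>X\<^esub> = x \<leadsto>\<^bsub>X\<^esub> y\<^sup>\<star>\<^bsub>X\<^esub>"

locale be_algebra =
  fixes X (structure)
  assumes imp_closed: "\<lbrakk>x \<in> carrier X; y \<in> carrier X\<rbrakk> \<Longrightarrow> x \<leadsto> y \<in> carrier X"
    and one_closed: "\<one> \<in> carrier X"
    and imp_self: "x \<in> carrier X \<Longrightarrow> x \<leadsto> x = \<one>"
    and imp_one: "x \<in> carrier X \<Longrightarrow> x \<leadsto> \<one> = \<one>"
    and one_imp: "x \<in> carrier X \<Longrightarrow> \<one> \<leadsto> x = x"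
    and imp_exchange: "\<lbrakk>x \<in> carrier X; y \<in> carrier X; z \<in> carrier X\<rbrakk>
      \<Longrightarrow> x \<leadsto> (y \<leadsto> z) = y \<leadsto> (x \<leadsto> z)"

locale bounded_be_algebra = be_algebra X for X (structure) +
  assumes zero_closed: "\<zero> \<in> carrier X"
    and zero_le: "x \<in> carrier X \<Longrightarrow> \<zero> \<preceq> x"

locale implicative_ortholattice = bounded_be_algebra X for X (structure) +
  assumes involutive: "x \<in> carrier X \<Longrightarrow> (x\<^sup>\<star>)\<^sup>\<star> = x"
    and implicative: "\<lbrakk>x \<in> carrier X; y \<in> carrier X\<rbrakk> \<Longrightarrow> (x \<leadsto> y) \<leadsto> x = x"

locale implicative_orthomodular_lattice = implicative_ortholattice X for X (structure) +
  assumes orthomodular: "\<lbrakk>x \<in> carrier X; y \<in> carrier X\<rbrakk> \<Longrightarrow> x \<sqinter> (y \<leadsto> x) = x"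

locale implicative_boolean_algebra = implicative_ortholattice X for X (structure) +
  assumes boolean: "\<lbrakk>x \<in> carrier X; y \<in> carrier X\<rbrakk> \<Longrightarrow> (y\<^sup>\<star> \<leadsto> x) \<leadsto> y = x \<leadsto> y"

end

theory Submission
  imports Defs
begin

text \<open>
  An implicative-ortholattice is an ortholattice in the usual sense: the exchange law makes
  \<open>x \<cdot> y = (x \<leadsto> y\<^sup>\<star>)\<^sup>\<star>\<close> a commutative and associative operation with De Morgan dual \<open>x\<^sup>\<star> \<leadsto> y\<close>,
  and implicativity is the absorption law between the two. In these terms \<open>x \<leadsto> y\<close> is
  \<open>x\<^sup>\<star> \<or> y\<close>, and \<open>x \<sqinter> y\<close> is the Sasaki projection \<open>(x \<or> y\<^sup>\<star>) \<and> y\<close> of \<open>x\<close> onto \<open>y\<close>.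

  Everything then turns on the law \<open>x \<sqinter> y = x \<cdot> y\<close>, that is \<open>(x \<or> y\<^sup>\<star>) \<and> y = x \<and> y\<close>.
  Exchanging the variables turns it into the commutativity relation between any two elements.
  Complemented, it reads \<open>y\<^sup>\<star> \<or> (x\<^sup>\<star> \<and> y) = y\<^sup>\<star> \<or> x\<^sup>\<star>\<close>, which is the divisibility relation
  and, with \<open>y\<^sup>\<star>\<close> in place of \<open>y\<close>, the Boolean axiom.
  The law makes \<open>\<sqinter>\<close> commutative because \<open>\<cdot>\<close> is. Conversely, \<open>x \<sqinter> y\<close> always lies between
  \<open>x \<cdot> y\<close> and \<open>y\<close>, so if it equals \<open>y \<sqinter> x\<close>, it also lies below \<open>x\<close> and is therefore \<open>x \<cdot> y\<close>
  (lemma \<open>meet_Q_eq_meet_if_commute\<close>). Commutativity of \<open>\<squnion>\<close> is the dual statement.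
\<close>

context implicative_ortholattice
begin

lemma compl_closed: "x \<in> carrier X \<Longrightarrow> x\<^sup>\<star> \<in> carrier X"
  by (simp add: compl_def imp_closed zero_closed)

lemma imp_compl_commute:
  assumes "x \<in> carrier X" "y \<in> carrier X"
  shows "x \<leadsto> y\<^sup>\<star> = y \<leadsto> x\<^sup>\<star>"
  unfolding compl_def using assms imp_exchange zero_closed by blast

lemma compl_imp_compl:
  assumes "x \<in> carrier X" "y \<in> carrier X"
  shows "x\<^sup>\<star> \<leadsto> y\<^sup>\<star> = y \<leadsto> x"
  using imp_compl_commute[of "x\<^sup>\<star>" y] assms by (simp add: compl_closed involutive)

lemma compl_inject:
  assumes "x \<in> carrier X" "y \<in> carrier X"
  shows "x\<^sup>\<star> = y\<^sup>\<star> \<longleftrightarrow> x = y"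
  using assms involutive by metis

text \<open>Complementation maps the carrier onto itself, so variables may be complemented in any law.\<close>

lemma all_compl_iff: "(\<forall>x \<in> carrier X. P (x\<^sup>\<star>)) \<longleftrightarrow> (\<forall>x \<in> carrier X. P x)"
  using compl_closed involutive by metis

definition meet :: "'a \<Rightarrow> 'a \<Rightarrow> 'a" (infixl \<open>\<cdot>\<close> 70)
  where "x \<cdot> y = (x \<leadsto> y\<^sup>\<star>)\<^sup>\<star>"

lemma meet_closed: "\<lbrakk>x \<in> carrier X; y \<in> carrier X\<rbrakk> \<Longrightarrow> x \<cdot> y \<in> carrier X"
  by (simp add: meet_def imp_closed compl_closed)

lemma meet_commute: "\<lbrakk>x \<in> carrier X; y \<in> carrier X\<rbrakk> \<Longrightarrow> x \<cdot> y = y \<cdot> x"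
  by (simp add: meet_def imp_compl_commute)

lemma meet_assoc:
  assumes "x \<in> carrier X" "y \<in> carrier X" "z \<in> carrier X"
  shows "(x \<cdot> y) \<cdot> z = x \<cdot> (y \<cdot> z)"
proof -
  have "(x \<leadsto> y\<^sup>\<star>)\<^sup>\<star> \<leadsto> z\<^sup>\<star> = z \<leadsto> (x \<leadsto> y\<^sup>\<star>)"
    using assms by (simp add: compl_imp_compl imp_closed compl_closed)
  also have "\<dots> = x \<leadsto> (y \<leadsto> z\<^sup>\<star>)"
    using assms by (simp add: imp_exchange[of z x] imp_compl_commute[of z y] compl_closed)
  finally show ?thesis
    using assms by (simp add: meet_def involutive imp_closed compl_closed)
qed

lemma meet_idem:
  assumes "x \<in> carrier X"
  shows "x \<cdot> x = x"
proof -
  have "(x\<^sup>\<star> \<leadsto> \<zero>) \<leadsto> x\<^sup>\<star> = x\<^sup>\<star>"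
    using assms by (simp add: implicative compl_closed zero_closed)
  moreover have "x\<^sup>\<star> \<leadsto> \<zero> = x"
    using involutive[OF assms] by (simp add: compl_def)
  ultimately show ?thesis
    using assms by (simp add: meet_def involutive)
qed

lemma meet_absorb:
  assumes "x \<in> carrier X" "y \<in> carrier X"
  shows "x \<cdot> (x\<^sup>\<star> \<leadsto> y) = x"
proof -
  have "(x\<^sup>\<star> \<leadsto> y) \<cdot> x = x"
    using assms by (simp add: meet_def implicative compl_closed involutive)
  then show ?thesis
    using assms by (simp add: meet_commute[of x] imp_closed compl_closed)
qed

lemma meet_Q_eq_meet_imp: "x \<sqinter> y = (x\<^sup>\<star> \<leadsto> y\<^sup>\<star>) \<cdot> y"
  by (simp add: meet_Q_def meet_def)

lemma join_Q_closed: "\<lbrakk>x \<in> carrier X; y \<in> carrier X\<rbrakk> \<Longrightarrow> x \<squnion> y \<in> carrier X"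
  by (simp add: join_Q_def imp_closed)

lemma meet_Q_eq_compl_join_Q: "x \<sqinter> y = (x\<^sup>\<star> \<squnion> y\<^sup>\<star>)\<^sup>\<star>"
  by (simp add: meet_Q_def join_Q_def)

lemma meet_meet_Q_right:
  assumes "x \<in> carrier X" "y \<in> carrier X"
  shows "y \<cdot> (x \<sqinter> y) = x \<sqinter> y"
proof -
  let ?p = "x\<^sup>\<star> \<leadsto> y\<^sup>\<star>"
  have p: "?p \<in> carrier X"
    using assms by (simp add: imp_closed compl_closed)
  have "y \<cdot> (?p \<cdot> y) = (?p \<cdot> y) \<cdot> y"
    using assms p by (simp add: meet_commute[of y "?p \<cdot> y"] meet_closed)
  also have "\<dots> = ?p \<cdot> y"
    using assms p by (simp add: meet_assoc meet_idem)
  finally show ?thesis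
    by (simp add: meet_Q_eq_meet_imp)
qed

text \<open>Absorption cancels the join with \<open>x\<close> inside the Sasaki projection of \<open>x\<close>.\<close>

lemma meet_meet_Q_left:
  assumes "x \<in> carrier X" "y \<in> carrier X"
  shows "x \<cdot> (x \<sqinter> y) = x \<cdot> y"
proof -
  have "x \<cdot> (x \<sqinter> y) = (x \<cdot> (x\<^sup>\<star> \<leadsto> y\<^sup>\<star>)) \<cdot> y"
    using assms by (simp add: meet_Q_eq_meet_imp meet_assoc imp_closed compl_closed)
  then show ?thesis
    using assms by (simp add: meet_absorb compl_closed)
qed

text \<open>
  If the two projections agree, their common value lies below \<open>x\<close> as well as below \<open>y\<close>, and
  meeting it with \<open>x\<close>, which then changes nothing, yields \<open>x \<cdot> y\<close>.
\<close>

lemma meet_Q_eq_meet_if_commute: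
  assumes "x \<in> carrier X" "y \<in> carrier X" and "x \<sqinter> y = y \<sqinter> x"
  shows "x \<sqinter> y = x \<cdot> y"
  using assms meet_meet_Q_left[of x y] meet_meet_Q_right[of y x] by simp

theorem meet_Q_commute_iff:
  "(\<forall>x \<in> carrier X. \<forall>y \<in> carrier X. x \<sqinter> y = y \<sqinter> x) \<longleftrightarrow>
   (\<forall>x \<in> carrier X. \<forall>y \<in> carrier X. x \<sqinter> y = x \<cdot> y)"
  using meet_Q_eq_meet_if_commute meet_commute by metis

theorem join_Q_commute_iff:
  "(\<forall>x \<in> carrier X. \<forall>y \<in> carrier X. x \<squnion> y = y \<squnion> x) \<longleftrightarrow>
   (\<forall>x \<in> carrier X. \<forall>y \<in> carrier X. x \<sqinter> y = y \<sqinter> x)"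
proof -
  have "x \<sqinter> y = y \<sqinter> x \<longleftrightarrow> x\<^sup>\<star> \<squnion> y\<^sup>\<star> = y\<^sup>\<star> \<squnion> x\<^sup>\<star>"
    if "x \<in> carrier X" "y \<in> carrier X" for x y
    using that by (simp add: meet_Q_eq_compl_join_Q compl_inject join_Q_closed compl_closed)
  then have "(\<forall>x \<in> carrier X. \<forall>y \<in> carrier X. x \<sqinter> y = y \<sqinter> x) \<longleftrightarrow>
      (\<forall>x \<in> carrier X. \<forall>y \<in> carrier X. x\<^sup>\<star> \<squnion> y\<^sup>\<star> = y\<^sup>\<star> \<squnion> x\<^sup>\<star>)"
    by blast
  then show ?thesis
    by (simp add: all_compl_iff[of "\<lambda>y. _ \<squnion> y = y \<squnion> _"]
        all_compl_iff[of "\<lambda>x. \<forall>y \<in> carrier X. x \<squnion> y = y \<squnion> x"])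
qed

theorem commutes_iff:
  "(\<forall>x \<in> carrier X. \<forall>y \<in> carrier X. x \<C> y \<and> y \<C> x) \<longleftrightarrow>
   (\<forall>x \<in> carrier X. \<forall>y \<in> carrier X. x \<sqinter> y = x \<cdot> y)"
proof -
  have "x \<C> y \<longleftrightarrow> y \<sqinter> x = y \<cdot> x" if "x \<in> carrier X" "y \<in> carrier X" for x y
    using meet_commute[OF that] by (simp add: commutes_def meet_def)
  then show ?thesis
    by blast
qed

text \<open>Complementing both sides turns \<open>y \<D> x\<close> into the agreement of \<open>x \<sqinter> y\<close> and \<open>x \<cdot> y\<close>.\<close>

lemma divides_iff_meet_Q_eq_meet:
  assumes "x \<in> carrier X" "y \<in> carrier X"
  shows "y \<D> x \<longleftrightarrow> x \<sqinter> y = x \<cdot> y"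
proof -
  have "x \<sqinter> y = (y \<leadsto> (y \<leadsto> x)\<^sup>\<star>)\<^sup>\<star>"
    using assms
    by (simp add: meet_Q_def compl_imp_compl imp_compl_commute[of "y \<leadsto> x" y] imp_closed)
  moreover have "x \<cdot> y = (y \<leadsto> x\<^sup>\<star>)\<^sup>\<star>"
    using assms by (simp add: meet_def imp_compl_commute[of x y])
  ultimately show ?thesis
    using assms by (simp add: divides_def compl_inject imp_closed compl_closed)
qed

theorem divides_iff:
  "(\<forall>x \<in> carrier X. \<forall>y \<in> carrier X. x \<D> y \<and> y \<D> x) \<longleftrightarrow>
   (\<forall>x \<in> carrier X. \<forall>y \<in> carrier X. x \<sqinter> y = x \<cdot> y)"
  using divides_iff_meet_Q_eq_meet by blast

text \<open>Contraposition, applied to both sides of the Boolean axiom, brings \<open>y\<close> to the front.\<close>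

lemma boolean_at_compl_iff_divides:
  assumes "x \<in> carrier X" "y \<in> carrier X"
  shows "((y\<^sup>\<star>)\<^sup>\<star> \<leadsto> x) \<leadsto> y\<^sup>\<star> = x \<leadsto> y\<^sup>\<star> \<longleftrightarrow> y \<D> x"
  using assms
  by (simp add: divides_def involutive imp_compl_commute[of _ y] imp_closed)

theorem boolean_algebra_iff:
  "implicative_boolean_algebra X \<longleftrightarrow>
   (\<forall>x \<in> carrier X. \<forall>y \<in> carrier X. x \<sqinter> y = x \<cdot> y)"
proof -
  have "implicative_boolean_algebra X \<longleftrightarrow>
      (\<forall>x \<in> carrier X. \<forall>y \<in> carrier X. (y\<^sup>\<star> \<leadsto> x) \<leadsto> y = x \<leadsto> y)"
    using implicative_ortholattice_axioms
    by (auto simp: implicative_boolean_algebra_def implicative_boolean_algebra_axioms_def)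
  also have "\<dots> \<longleftrightarrow>
      (\<forall>x \<in> carrier X. \<forall>y \<in> carrier X. ((y\<^sup>\<star>)\<^sup>\<star> \<leadsto> x) \<leadsto> y\<^sup>\<star> = x \<leadsto> y\<^sup>\<star>)"
    by (simp only: all_compl_iff[of "\<lambda>y. (y\<^sup>\<star> \<leadsto> _) \<leadsto> y = _ \<leadsto> y"])
  also have "\<dots> \<longleftrightarrow> (\<forall>x \<in> carrier X. \<forall>y \<in> carrier X. x \<sqinter> y = x \<cdot> y)"
    by (simp add: boolean_at_compl_iff_divides divides_iff_meet_Q_eq_meet)
  finally show ?thesis .
qed

end

theorem theorem5p6:
  fixes X :: "('a, 'm) bounded_be_algebra_scheme" (structure)
  assumes "implicative_orthomodular_lattice X"
  shows
    "(implicative_boolean_algebra X \<longleftrightarrow>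
        (\<forall>x \<in> carrier X. \<forall>y \<in> carrier X. x \<sqinter> y = (x \<leadsto> y\<^sup>\<star>)\<^sup>\<star>)) \<and>
     (implicative_boolean_algebra X \<longleftrightarrow>
        (\<forall>x \<in> carrier X. \<forall>y \<in> carrier X. x \<sqinter> y = y \<sqinter> x)) \<and>
     (implicative_boolean_algebra X \<longleftrightarrow>
        (\<forall>x \<in> carrier X. \<forall>y \<in> carrier X. x \<squnion> y = y \<squnion> x)) \<and>
     (implicative_boolean_algebra X \<longleftrightarrow>
        (\<forall>x \<in> carrier X. \<forall>y \<in> carrier X. x \<C> y \<and> y \<C> x)) \<and>
     (implicative_boolean_algebra X \<longleftrightarrow>
        (\<forall>x \<in> carrier X. \<forall>y \<in> carrier X. x \<D> y \<and> y \<D> x))"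
proof -
  interpret implicative_orthomodular_lattice X
    by (fact assms)
  show ?thesis
    unfolding join_Q_commute_iff meet_Q_commute_iff commutes_iff divides_iff boolean_algebra_iff
    by (simp add: meet_def)
qed

end
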